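(* For every integer $n\ge 0$ let $O_n$ be the $n$-overhand knot and $O_n(x)$ its generating polynomial (with $O_0$ the unknot, $O_0(x)=x$). Then $O_n(x)$ satisfies the recurrence $$O_n(x)=(x^2+4x+3)\,O_{n-1}(x)\qquad (n\ge 1),$$ and is given by the closed form $$O_n(x)=x\left(x^2+4x+3\right)^n\qquad (n\ge 0).$$
   Context: A knot (diagram) means a shadow on the sphere $S^2$: a finite collection of closed curves whose only singularities are finitely many transverse double points, called crossings, with no over/under information, considered up to planar isotopy (several components and crossingless circles are allowed). The unknot $U$ is a single simple closed curve. Each crossing can be split in two ways: remove the crossing and reconnect the four ends in one of the two planar non-crossing ways that join adjacent ends (type $0$ and type $1$ splits). A state of a knot $K$ with $m$ crossings is one of the $2^m$ diagrams obtained by choosing a split at each crossing; it is a disjoint union of simple closed curves (circles), and $|S|$ denotes the number of circles of the state $S$. The generating polynomial of $K$ is $K(x)=\sum_S x^{|S|}$, summed over all $2^m$ states. The connected sum of two knots is obtained by removing a small arc from each and joining the four endpoints by two new arcs without introducing new crossings. The $n$-overhand knot $O_n$ is the shadow obtained by joining the two loose ends of a series of $n$ overhand knots; it is the connected sum of $n$ copies of its generator $O_1$, with $O_0=U$. The generator $O_1$ is the standard three-crossing trefoil shadow drawn as follows: three crossings stacked vertically, the two lower ends of each crossing joined to the two upper ends of the next one below (left to left, right to right), the upper left end of the top crossing joined to the lower left end of the bottom crossing by a left arc, and the upper right end of the top crossing joined to the lower right end of the bottom crossing by a right arc. Consecutive copies in $O_n$ are connected by a sum of the right arc of one copy with the left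 arc of the next. *)

theory Defs
  imports "HOL-Computational_Algebra.Polynomial" "HOL-Library.FuncSet"
begin

text \<open>
  A shadow on the sphere is encoded by its planar map. The crossings are
  \<open>0, \<dots>, ncross - 1\<close>; each has four ends, named after their position
  around the crossing. The strands running between crossings are given by \<open>arc\<close>, which sends
  each end to the end at the other side of its strand. Components without crossings are
  not visible to \<open>arc\<close> and are counted by \<open>circles\<close>.
\<close>

datatype corner = UL | LL | LR | UR

type_synonym cend = "nat \<times> corner"

record shadow =
  ncross :: nat
  arc :: "cend \<Rightarrow> cend"
  circles :: nat

definition ends :: "shadow \<Rightarrow> cend set" where
  "ends D = {..<ncross D} \<times> UNIV"

fun next_ccw :: "cend \<Rightarrow> cend" where
  "next_ccw (i, UL) = (i, LL)"
| "next_ccw (i, LL) = (i, LR)"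
| "next_ccw (i, LR) = (i, UR)"
| "next_ccw (i, UR) = (i, UL)"

definition num_classes :: "'a set \<Rightarrow> ('a \<Rightarrow> 'a \<Rightarrow> bool) \<Rightarrow> nat" where
  "num_classes A r = card (A // {(x, y). equivclp r x y})"

text \<open>
  Faces are traced by following a strand and then turning to the adjacent end. As
  there are \<open>2 * ncross\<close> strands, Euler's formula \<open>V - E + F = 2\<close> for every
  connected component reads \<open>F = ncross + 2 * C\<close>, and it says that the map embeds in
  the sphere. Here the faces of different components are counted separately.
\<close>

definition num_faces :: "shadow \<Rightarrow> nat" where
  "num_faces D = num_classes (ends D) (\<lambda>e f. e \<in> ends D \<and> f = next_ccw (arc D e))"

definition num_components :: "shadow \<Rightarrow> nat" where
  "num_components D =
     num_classes (ends D)
       (\<lambda>e f. e \<in> ends D \<and> f \<in> ends D \<and> (f = arc D e \<or> fst f = fst e))"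

definition is_shadow :: "shadow \<Rightarrow> bool" where
  "is_shadow D \<longleftrightarrow>
     (\<forall>e\<in>ends D. arc D e \<in> ends D \<and> arc D e \<noteq> e \<and> arc D (arc D e) = e) \<and>
     num_faces D = ncross D + 2 * num_components D"

datatype split = Split0 | Split1

text \<open>The two ways of reconnecting adjacent ends after removing a crossing.\<close>

fun splice :: "split \<Rightarrow> corner \<Rightarrow> corner" where
  "splice Split0 UL = UR"
| "splice Split0 UR = UL"
| "splice Split0 LL = LR"
| "splice Split0 LR = LL"
| "splice Split1 UL = LL"
| "splice Split1 LL = UL"
| "splice Split1 UR = LR"
| "splice Split1 LR = UR"

definition states :: "shadow \<Rightarrow> (nat \<Rightarrow> split) set" where
  "states D = {..<ncross D} \<rightarrow>\<^sub>E UNIV"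

text \<open>
  A state joins two ends if they bound the same strand or are reconnected by a split;
  its circles are the connected components of this relation, together with the
  components that had no crossings to begin with.
\<close>

definition joined :: "shadow \<Rightarrow> (nat \<Rightarrow> split) \<Rightarrow> cend \<Rightarrow> cend \<Rightarrow> bool" where
  "joined D S e f \<longleftrightarrow>
     e \<in> ends D \<and> (f = arc D e \<or> f = (fst e, splice (S (fst e)) (snd e)))"

definition num_circles :: "shadow \<Rightarrow> (nat \<Rightarrow> split) \<Rightarrow> nat" where
  "num_circles D S = circles D + num_classes (ends D) (joined D S)"

definition gen_poly :: "shadow \<Rightarrow> int poly" where
  "gen_poly D = (\<Sum>S\<in>states D. monom 1 (num_circles D S))"

text \<open>
  The place where a connected sum is performed: either the strand starting at a given end,
  directed away from that end, or a crossingless circle.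
\<close>

datatype strand = Strand cend | Circle

definition shift :: "nat \<Rightarrow> cend \<Rightarrow> cend" where
  "shift m e = (m + fst e, snd e)"

definition juxtapose :: "shadow \<Rightarrow> shadow \<Rightarrow> cend \<Rightarrow> cend" where
  "juxtapose D D' e =
     (if fst e < ncross D then arc D e
      else shift (ncross D) (arc D' (fst e - ncross D, snd e)))"

text \<open>
  The two cut strands are placed next to each other pointing in the same direction, so that
  start is joined to start and target to target. With a crossingless circle as one of
  the two strands, the sum merely absorbs that circle (which presupposes that the diagram
  has one).
\<close>

fun connected_sum :: "shadow \<Rightarrow> strand \<Rightarrow> shadow \<Rightarrow> strand \<Rightarrow> shadow" where
  "connected_sum D (Strand d) D' (Strand d') =
     (let p = d; q = arc D d; p' = shift (ncross D) d'; q' = shift (ncross D) (arc D' d')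
      in \<lparr> ncross = ncross D + ncross D',
           arc = (juxtapose D D')(p := p', p' := p, q := q', q' := q),
           circles = circles D + circles D' \<rparr>)"
| "connected_sum D _ D' _ =
     \<lparr> ncross = ncross D + ncross D',
       arc = juxtapose D D',
       circles = circles D + circles D' - 1 \<rparr>"

definition unknot :: shadow where
  "unknot = \<lparr> ncross = 0, arc = id, circles = 1 \<rparr>"

text \<open>The trefoil shadow as a vertical stack, with crossing \<open>0\<close> on top.\<close>

definition trefoil :: shadow where
  "trefoil = \<lparr> ncross = 3,
     arc = (\<lambda>(i, c). case c of
        UL \<Rightarrow> if i = 0 then (2, LL) else (i - 1, LL)
      | UR \<Rightarrow> if i = 0 then (2, LR) else (i - 1, LR)
      | LL \<Rightarrow> if i = 2 then (0, UL) else (i + 1, UL)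
      | LR \<Rightarrow> if i = 2 then (0, UR) else (i + 1, UR)),
     circles = 0 \<rparr>"

text \<open>
  The right arc of the last copy in the \<open>n\<close>-overhand knot, directed downwards; the top
  crossing of the last copy is \<open>3 * (n - 1)\<close>.
\<close>

fun right_arc :: "nat \<Rightarrow> strand" where
  "right_arc 0 = Circle"
| "right_arc (Suc n) = Strand (3 * n, UR)"

definition left_arc :: strand where
  "left_arc = Strand (0, UL)"

fun overhand :: "nat \<Rightarrow> shadow" where
  "overhand 0 = unknot"
| "overhand (Suc n) = connected_sum (overhand n) (right_arc n) trefoil left_arc"

lemma overhand_1: "overhand 1 = trefoil"
  by (simp add: unknot_def trefoil_def left_arc_def juxtapose_def shift_def fun_eq_iff
      split: corner.split)

subsection \<open>The overhand knots are spherical shadows\<close>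

lemma connected_sum_ncross: "ncross (connected_sum D a D' b) = ncross D + ncross D'"
  by (cases a; cases b) (simp_all add: Let_def)

lemma overhand_ncross: "ncross (overhand n) = 3 * n"
  by (induction n) (simp_all add: connected_sum_ncross unknot_def trefoil_def)

definition overhand_arc :: "nat \<Rightarrow> cend \<Rightarrow> cend" where
  "overhand_arc n = (\<lambda>(i, c). case c of
     UL \<Rightarrow> if i mod 3 = 0 then (if i = 0 then (2, LL) else (i - 3, UR)) else (i - 1, LL)
   | LL \<Rightarrow> if i mod 3 = 2 then (if i = 2 then (0, UL) else (i - 3, LR)) else (i + 1, UL)
   | UR \<Rightarrow> if i mod 3 = 0 then (if i + 3 = 3 * n then (i + 2, LR) else (i + 3, UL))
           else (i - 1, LR)
   | LR \<Rightarrow> if i mod 3 = 2 then (if i + 1 = 3 * n then (i - 2, UR) else (i + 3, LL))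
           else (i + 1, UR))"

lemma mod3: "Suc (3 * k) mod 3 = 1" "Suc (Suc (3 * k)) mod 3 = 2" for k :: nat
  by presburger+

lemma index_cases:
  obtains k j :: nat where "i = 3 * k + j" "j = 0 \<or> j = 1 \<or> j = 2"
proof -
  have "i mod 3 = 0 \<or> i mod 3 = 1 \<or> i mod 3 = 2" by presburger
  then show ?thesis
    using that[of "i div 3" "i mod 3"] by simp
qed

lemma overhand_arc:
  "i < 3 * n \<Longrightarrow> arc (overhand n) (i, c) = overhand_arc n (i, c)"
proof (induction n arbitrary: i c)
  case 0
  then show ?case by simp
next
  case (Suc n)
  show ?case
  proof (cases n)
    case 0
    with Suc.prems have "i = 0 \<or> i = 1 \<or> i = 2" by auto
    with 0 show ?thesis
      by (auto simp: unknot_def trefoil_def left_arc_def juxtapose_def shift_def overhand_arc_def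
          split: corner.split)
  next
    case (Suc m)
    have q: "arc (overhand n) (3 * m, UR) = (3 * m + 2, LR)"
      using Suc.IH[of "3 * m" UR] Suc by (simp add: overhand_arc_def)
    have q': "arc trefoil (0, UL) = (2, LL)"
      by (simp add: trefoil_def)
    have ra: "right_arc n = Strand (3 * m, UR)" using Suc by simp
    have eq: "arc (overhand (Suc n)) = (juxtapose (overhand n) trefoil)
        ((3 * m, UR) := (3 * n, UL), (3 * n, UL) := (3 * m, UR),
         (3 * m + 2, LR) := (3 * n + 2, LL), (3 * n + 2, LL) := (3 * m + 2, LR))"
      by (simp add: ra left_arc_def q q' Let_def overhand_ncross shift_def)
    obtain k j where kj: "i = 3 * k + j" "j = 0 \<or> j = 1 \<or> j = 2" by (rule index_cases)
    have kn: "k < n \<or> k = n" using kj Suc.prems by auto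
    show ?thesis
    proof (cases "k < n")
      case True
      then have "juxtapose (overhand n) trefoil (i, c) = overhand_arc n (i, c)"
        using Suc.IH[of i c] kj by (auto simp: juxtapose_def overhand_ncross)
      then show ?thesis
        unfolding eq using True Suc kj
        by (cases c) (auto simp: overhand_arc_def, presburger+)
    next
      case False
      then have i: "i = 3 * n + j" using kn kj by simp
      then have jux: "juxtapose (overhand n) trefoil (i, c) = shift (3 * n) (arc trefoil (j, c))"
        by (simp add: juxtapose_def overhand_ncross)
      show ?thesis
        unfolding eq fun_upd_apply jux unfolding i Suc
        by (insert kj(2); elim disjE; cases c)
          (simp_all add: trefoil_def shift_def overhand_arc_def mod3)
    qed
  qed
qed

lemma num_classes_eq_card_labels:
  assumes inv: "\<And>x y. r x y \<Longrightarrow> lab x = lab y"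
    and rep: "\<And>x. x \<in> A \<Longrightarrow> equivclp r x (rep (lab x))"
  shows "num_classes A r = card (lab ` A)"
proof -
  let ?R = "{(x, y). equivclp r x y}"
  have lab: "lab x = lab y" if "equivclp r x y" for x y
    using that by (induction rule: equivclp_induct) (use inv in metis)+
  have cls: "?R `` {x} = ?R `` {rep (lab x)}" if "x \<in> A" for x
  proof (rule equiv_class_eq)
    show "equiv UNIV ?R"
      by (simp add: equivp_equiv)
    show "(x, rep (lab x)) \<in> ?R"
      using rep[OF that] by simp
  qed
  have "A // ?R = (\<lambda>l. ?R `` {rep l}) ` lab ` A"
  proof -
    have "A // ?R = (\<lambda>x. ?R `` {x}) ` A" by (auto simp: quotient_def)
    also have "\<dots> = (\<lambda>x. ?R `` {rep (lab x)}) ` A" by (rule image_cong[OF refl cls])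
    finally show ?thesis by (simp add: image_image)
  qed
  moreover have "inj_on (\<lambda>l. ?R `` {rep l}) (lab ` A)"
  proof (rule inj_onI)
    fix l l' assume "l \<in> lab ` A" "l' \<in> lab ` A" and eq: "?R `` {rep l} = ?R `` {rep l'}"
    have "lab (rep l) = l" if "l \<in> lab ` A" for l
      using that by (elim imageE) (simp add: lab[OF rep, symmetric])
    then have "lab (rep l) = l" "lab (rep l') = l'"
      using \<open>l \<in> lab ` A\<close> \<open>l' \<in> lab ` A\<close> by blast+
    moreover have "rep l' \<in> ?R `` {rep l}" by (subst eq) simp
    then have "equivclp r (rep l) (rep l')" by simp
    then have "lab (rep l) = lab (rep l')" by (rule lab)
    ultimately show "l = l'" by metis
  qed
  ultimately show ?thesis
    unfolding num_classes_def by (simp only: card_image)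
qed

lemma overhand_involution:
  assumes "e \<in> ends (overhand n)"
  shows "arc (overhand n) e \<in> ends (overhand n) \<and> arc (overhand n) e \<noteq> e \<and>
         arc (overhand n) (arc (overhand n) e) = e"
proof -
  obtain i c where e: "e = (i, c)" by (cases e)
  with assms have i: "i < 3 * n" by (simp add: ends_def overhand_ncross)
  obtain k j where kj: "i = 3 * k + j" "j = 0 \<or> j = 1 \<or> j = 2" by (rule index_cases)
  have 1: "overhand_arc n e \<in> ends (overhand n) \<and> overhand_arc n e \<noteq> e \<and>
         overhand_arc n (overhand_arc n e) = e"
  proof -
    consider "j = 0" | "j = 1" | "j = 2" using kj(2) by blast
    then show ?thesis
    proof cases
      case 1
      then show ?thesis using kj(1) i e
        by (cases c; cases k) (auto simp: overhand_arc_def ends_def overhand_ncross, presburger+)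
    next
      case 2
      then show ?thesis using kj(1) i e
        by (cases c; cases k) (auto simp: overhand_arc_def ends_def overhand_ncross, presburger+)
    next
      case 3
      then show ?thesis using kj(1) i e
        by (cases c; cases k) (auto simp: overhand_arc_def ends_def overhand_ncross, presburger+)
    qed
  qed
  moreover have "arc (overhand n) f = overhand_arc n f" if "f \<in> ends (overhand n)" for f
    using that overhand_arc[of "fst f" n "snd f"] by (auto simp: ends_def overhand_ncross)
  ultimately show ?thesis
    using assms by simp
qed

lemma overhand_num_faces:
  assumes "n > 0"
  shows "num_faces (overhand n) = 3 * n + 2"
proof -
  define r where "r = (\<lambda>e f. e \<in> ends (overhand n) \<and> f = next_ccw (arc (overhand n) e))"
  define lab :: "cend \<Rightarrow> nat \<times> nat" where "lab = (\<lambda>(i, c). case c of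
      LL \<Rightarrow> (0, i div 3)
    | UR \<Rightarrow> (0, i div 3 + 1)
    | UL \<Rightarrow> if i mod 3 = 0 then (1, 0) else (2, 2 * (i div 3) + i mod 3 - 1)
    | LR \<Rightarrow> if i mod 3 = 2 then (1, 0) else (2, 2 * (i div 3) + i mod 3))"
  define rep :: "nat \<times> nat \<Rightarrow> cend" where "rep = (\<lambda>(t, b).
      if t = 0 then (if b < n then (3 * b, LL) else (3 * (n - 1), UR))
      else if t = 1 then (0, UL)
      else (3 * (b div 2) + b mod 2, LR))"
  have r: "r (i, c) f \<longleftrightarrow> i < 3 * n \<and> f = next_ccw (overhand_arc n (i, c))" for i c f
    by (auto simp: r_def ends_def overhand_ncross overhand_arc)
  have inv: "lab e = lab f" if "r e f" for e f
  proof -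
    obtain i c where e: "e = (i, c)" by (cases e)
    obtain k j where kj: "i = 3 * k + j" "j = 0 \<or> j = 1 \<or> j = 2" by (rule index_cases)
    have f: "f = next_ccw (overhand_arc n (3 * k + j, c))" and "k < n"
      using that e kj by (auto simp: r)
    show ?thesis
      unfolding e f kj(1) using kj(2)
      by (elim disjE; cases c; cases k) (simp_all add: overhand_arc_def lab_def mod3)
  qed
  have step: "equivclp r e f" if "r e f" for e f
    using that by (rule r_into_equivclp)
  have top: "equivclp r (3 * k, UL) (0, UL)" if "k < n" for k
    using that
  proof (induction k)
    case (Suc k)
    have "r (3 * Suc k, UL) (3 * k, UL)" using Suc.prems by (simp add: r overhand_arc_def mod3)
    then show ?case using Suc by (meson Suc_lessD equivclp_trans step)
  qed simp
  have bot: "equivclp r (3 * k + 2, LR) (0, UL)" if "k < n" for k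
    using that
  proof (induction k)
    case 0
    have "r (0, UL) (2, LR)" using assms by (simp add: r overhand_arc_def mod3)
    then have "equivclp r (2, LR) (0, UL)" by (blast intro: equivclp_sym step)
    then show ?case by (metis add_0 mult_0_right)
  next
    case (Suc k)
    have "r (3 * k + 2, LR) (3 * Suc k + 2, LR)"
      using Suc.prems by (simp add: r overhand_arc_def mod3)
    then show ?case using Suc by (meson Suc_lessD equivclp_trans equivclp_sym step)
  qed
  have rep: "equivclp r e (rep (lab e))" if "e \<in> ends (overhand n)" for e
  proof -
    obtain i c where e: "e = (i, c)" by (cases e)
    obtain k j where kj: "i = 3 * k + j" "j = 0 \<or> j = 1 \<or> j = 2" by (rule index_cases)
    have i: "i < 3 * n" and k: "k < n"
      using that e kj by (auto simp: ends_def overhand_ncross)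
    show ?thesis
    proof (cases c)
      case UL
      have "equivclp r (3 * k + 1, UL) (3 * k, LR)" "equivclp r (3 * k + 2, UL) (3 * k + 1, LR)"
        using k by (auto intro!: step simp: r overhand_arc_def mod3)
      then show ?thesis
        using kj e UL top[OF k] by (auto simp: lab_def rep_def mod3)
    next
      case LR
      then show ?thesis
        using kj e bot[OF k] by (auto simp: lab_def rep_def mod3)
    next
      case LL
      have 1: "equivclp r (3 * k, LL) (3 * k + 1, LL)"
          "equivclp r (3 * k + 1, LL) (3 * k + 2, LL)"
        using k by (auto intro!: step simp: r overhand_arc_def mod3)
      then have "equivclp r (3 * k + j, LL) (3 * k, LL)"
        using kj equivclp_trans[OF 1] by (auto intro: equivclp_sym)
      then show ?thesis
        using kj e LL k by (auto simp: lab_def rep_def mod3)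
    next
      case UR
      have 1: "equivclp r (3 * k + 1, UR) (3 * k, UR)"
          "equivclp r (3 * k + 2, UR) (3 * k + 1, UR)"
        using k by (auto intro!: step simp: r overhand_arc_def mod3)
      then have 2: "equivclp r (3 * k + j, UR) (3 * k, UR)"
        using kj equivclp_trans[OF 1(2) 1(1)] by auto
      have "equivclp r (3 * k, UR) (3 * (k + 1), LL)" if "k + 1 < n"
        using that by (intro step) (simp add: r overhand_arc_def mod3)
      moreover have "3 * k = 3 * (n - 1)" if "\<not> k + 1 < n"
        using that k by simp
      ultimately have "equivclp r (3 * k + j, UR) (rep (0, k + 1))"
        using 2 unfolding rep_def by (auto intro: equivclp_trans)
      then show ?thesis
        using kj e UR by (auto simp: lab_def)
    qed
  qed
  have "lab ` ends (overhand n) = {0} \<times> {..n} \<union> {(1, 0)} \<union> {2} \<times> {..<2 * n}"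
  proof (intro equalityI subsetI)
    fix l assume "l \<in> lab ` ends (overhand n)"
    then obtain i c where l: "l = lab (i, c)" and i: "i < 3 * n"
      by (auto simp: ends_def overhand_ncross)
    obtain k j where kj: "i = 3 * k + j" "j = 0 \<or> j = 1 \<or> j = 2" by (rule index_cases)
    show "l \<in> {0} \<times> {..n} \<union> {(1, 0)} \<union> {2} \<times> {..<2 * n}"
      using l i kj by (cases c) (auto simp: lab_def)
  next
    fix l :: "nat \<times> nat" assume "l \<in> {0} \<times> {..n} \<union> {(1, 0)} \<union> {2} \<times> {..<2 * n}"
    then consider (face) b where "l = (0, b)" "b \<le> n" | (outer) "l = (1, 0)"
      | (bigon) b where "l = (2, b)" "b < 2 * n" by auto
    then have "lab (rep l) = l \<and> rep l \<in> ends (overhand n)"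
    proof cases
      case (face b)
      then show ?thesis using assms by (auto simp: lab_def rep_def ends_def overhand_ncross)
    next
      case outer
      then show ?thesis using assms by (auto simp: lab_def rep_def ends_def overhand_ncross)
    next
      case (bigon b)
      obtain k j where b: "b = 2 * k + j" and "j < 2"
        using mult_div_mod_eq[of 2 b] by (metis mod_less_divisor zero_less_numeral)
      then have j: "j = 0 \<or> j = 1" and rep: "rep l = (3 * k + j, LR)"
        using bigon by (auto simp: rep_def)
      have "k < n" using bigon b by simp
      then show ?thesis
        unfolding rep using bigon b j by (auto simp: lab_def ends_def overhand_ncross mod3)
    qed
    then show "l \<in> lab ` ends (overhand n)" by (metis imageI)
  qed
  moreover have "card ({0 :: nat} \<times> {..n} \<union> {(1, 0 :: nat)} \<union> {2} \<times> {..<2 * n}) = 3 * n + 2"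
    by (subst card_Un_disjoint; (subst card_Un_disjoint)?) auto
  ultimately show ?thesis
    unfolding num_faces_def using num_classes_eq_card_labels[of r lab _ rep] inv rep
    by (simp add: r_def)
qed

lemma overhand_num_components:
  assumes "n > 0"
  shows "num_components (overhand n) = 1"
proof -
  define r where "r = (\<lambda>e f. e \<in> ends (overhand n) \<and> f \<in> ends (overhand n) \<and>
    (f = arc (overhand n) e \<or> fst f = fst e))"
  have ends: "(i, c) \<in> ends (overhand n) \<longleftrightarrow> i < 3 * n" for i c
    by (simp add: ends_def overhand_ncross)
  have same: "equivclp r (i, c) (i, d)" if "i < 3 * n" for i c d
    using that by (intro r_into_equivclp) (simp add: r_def ends)
  have UL: "equivclp r (i, UL) (0, UL)" if "i < 3 * n" for i
    using that
  proof (induction i rule: less_induct)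
    case (less i)
    show ?case
    proof (cases "i = 0")
      case False
      let ?f = "overhand_arc n (i, UL)"
      have f: "fst ?f < i"
        using False by (auto simp: overhand_arc_def)
      have "r (i, UL) ?f"
        using less.prems f by (cases ?f) (auto simp: r_def ends overhand_arc)
      moreover have "equivclp r ?f (fst ?f, UL)"
        using same[of "fst ?f" "snd ?f" UL] f less.prems by simp
      moreover have "equivclp r (fst ?f, UL) (0, UL)"
        using less.IH[OF f] f less.prems by simp
      ultimately show ?thesis
        by (meson equivclp_trans r_into_equivclp)
    qed simp
  qed
  have "num_classes (ends (overhand n)) r = card ((\<lambda>_ :: cend. 0 :: nat) ` ends (overhand n))"
  proof (rule num_classes_eq_card_labels)
    fix e assume "e \<in> ends (overhand n)"
    then show "equivclp r e (0, UL)"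
      by (cases e) (metis ends same UL equivclp_trans)
  qed simp
  moreover have "(0, UL) \<in> ends (overhand n)" using assms by (simp add: ends)
  then have "(\<lambda>_ :: cend. 0 :: nat) ` ends (overhand n) = {0}" by auto
  ultimately have "num_classes (ends (overhand n)) r = 1"
    by simp
  then show ?thesis
    by (simp only: num_components_def r_def)
qed

lemma is_shadow_overhand: "is_shadow (overhand n)"
proof (cases "n = 0")
  case True
  then show ?thesis
    by (simp add: is_shadow_def num_faces_def num_components_def num_classes_def ends_def
        unknot_def)
next
  case False
  then show ?thesis
    using overhand_involution
    by (simp add: is_shadow_def overhand_num_faces overhand_num_components overhand_ncross)
qed

end

theory Submission
  imports Defs
begin

text \<open>
  The theorem rests on the multiplicativity of the generating polynomial: for a connected sum
  \<open>E\<close> of \<open>D\<close> and \<open>D'\<close> along two strands,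
  \<open>x * E(x) = D(x) * D'(x)\<close> (\<open>gen_poly_connected_sum\<close>). A state of \<open>E\<close> is a
  state of \<open>D\<close> together with a state of \<open>D'\<close>, and the sum fuses the circle of
  the one through the cut strand with the circle of the other, so that exactly one circle is lost
  (\<open>num_circles_connected_sum\<close>).

  That fusion yields a single circle needs an argument, as circles are defined here as
  classes of a relation: a circle must stay connected when one of its strands is cut. This
  is a parity argument (\<open>cut_circle_connected\<close>). If the two ends of the cut strand fell
  apart, the splits would pair up all the ends of the piece that contains one of them,
  while the strands would pair up all of its ends but that one.

  It remains to find the polynomial of the trefoil shadow. A state with \<open>k > 0\<close> splits of
  type \<open>0\<close> (horizontal ones) has \<open>k\<close> circles, one between each pair of cyclically consecutive
  horizontal splits, and the state without any has two, a left and a right one. Hence it is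
  \<open>(1 + x)^3 - 1 + x^2 = x * (x^2 + 4 * x + 3)\<close>, and each further summand multiplies the polynomial
  of the overhand knot by \<open>x^2 + 4 * x + 3\<close>.
\<close>

section \<open>Cutting a circle\<close>

lemma even_card_if_fixpoint_free_involution:
  assumes "finite A" and "\<And>x. x \<in> A \<Longrightarrow> f x \<in> A \<and> f x \<noteq> x \<and> f (f x) = x"
  shows "even (card A)"
  using assms
proof (induction A rule: finite_psubset_induct)
  case (psubset A)
  show ?case
  proof (cases "A = {}")
    case False
    then obtain x where x: "x \<in> A" by blast
    let ?B = "A - {x, f x}"
    have "even (card ?B)"
    proof (rule psubset.IH)
      show "?B \<subset> A" using x by blast
      show "f y \<in> ?B \<and> f y \<noteq> y \<and> f (f y) = y" if "y \<in> ?B" for y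
        using that psubset.prems x by (metis Diff_iff insert_iff singletonD)
    qed
    moreover have "card A = card ?B + card {x, f x}"
    proof -
      have "card A = card (?B \<union> {x, f x})"
        using psubset.prems[OF x] x by (intro arg_cong[where f = card]) blast
      also have "\<dots> = card ?B + card {x, f x}"
        using \<open>finite A\<close> by (intro card_Un_disjoint) auto
      finally show ?thesis .
    qed
    moreover have "card {x, f x} = 2"
      using psubset.prems[OF x] by auto
    ultimately show ?thesis by simp
  qed simp
qed

text \<open>
  Two fixpoint-free involutions \<open>a\<close> and \<open>s\<close> decompose a set into cycles that follow them
  alternately; a cycle without its edge from \<open>p\<close> to \<open>a p\<close> is a path between these two points.
  Cycles can be avoided: let \<open>C\<close> be the points connected with \<open>p\<close> after the cut. Then \<open>s\<close>
  pairs up the points of \<open>C\<close>, but if \<open>a p\<close> were missing, \<open>a\<close> would pair up those of \<open>C - {p}\<close>.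
\<close>

lemma cut_circle_connected:
  assumes fin: "finite A"
    and a: "\<And>x. x \<in> A \<Longrightarrow> a x \<in> A \<and> a x \<noteq> x \<and> a (a x) = x"
    and s: "\<And>x. x \<in> A \<Longrightarrow> s x \<in> A \<and> s x \<noteq> x \<and> s (s x) = x"
    and p: "p \<in> A"
    and rs: "\<And>x. x \<in> A \<Longrightarrow> r x (s x)"
    and ra: "\<And>x. x \<in> A \<Longrightarrow> x \<noteq> p \<Longrightarrow> x \<noteq> a p \<Longrightarrow> r x (a x)"
  shows "equivclp r p (a p)"
proof (rule ccontr)
  assume not: "\<not> equivclp r p (a p)"
  define C where "C = {x \<in> A. equivclp r p x}"
  have finC: "finite C" using fin by (simp add: C_def)
  have "even (card C)"
  proof (rule even_card_if_fixpoint_free_involution[OF finC])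
    fix x assume "x \<in> C"
    then show "s x \<in> C \<and> s x \<noteq> x \<and> s (s x) = x"
      using s rs by (auto simp: C_def intro: equivclp_into_equivclp)
  qed
  moreover have "even (card (C - {p}))"
  proof (rule even_card_if_fixpoint_free_involution[of _ a])
    fix x assume x: "x \<in> C - {p}"
    then have "x \<noteq> a p" using not by (auto simp: C_def)
    then have "equivclp r p (a x)"
      using x ra by (auto simp: C_def intro: equivclp_into_equivclp)
    moreover have "a x \<noteq> p"
      using x a \<open>x \<noteq> a p\<close> by (auto simp: C_def)
    ultimately show "a x \<in> C - {p} \<and> a x \<noteq> x \<and> a (a x) = x"
      using x a by (auto simp: C_def)
  qed (use finC in simp)
  moreover have "card C = Suc (card (C - {p}))"
    using p finC by (intro card.remove) (auto simp: C_def)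
  ultimately show False by simp
qed

section \<open>Gluing two families of classes\<close>

text \<open>The variant of \<open>num_classes_eq_card_labels\<close> in which representatives need not be named.\<close>

lemma num_classes_eq_card_image:
  assumes "\<And>x y. r x y \<Longrightarrow> lab x = lab y"
    and "\<And>x y. x \<in> A \<Longrightarrow> y \<in> A \<Longrightarrow> lab x = lab y \<Longrightarrow> equivclp r x y"
  shows "num_classes A r = card (lab ` A)"
  by (rule num_classes_eq_card_labels[where rep = "inv_into A lab"])
    (use assms in \<open>auto simp: inv_into_into f_inv_into_f\<close>)

lemma equivclp_map:
  assumes "equivclp r x y" and "\<And>x y. r x y \<Longrightarrow> equivclp t (f x) (f y)"
  shows "equivclp t (f x) (f y)"
  using assms(1)
  by (induction rule: equivclp_induct)
    (use assms(2) in \<open>blast intro: equivclp_trans equivclp_sym equivclp_refl\<close>)+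

lemma equivclp_class_eq_iff:
  "{(x, y). equivclp r x y} `` {x} = {(x, y). equivclp r x y} `` {y} \<longleftrightarrow> equivclp r x y"
  by (auto intro: equivclp_trans equivclp_sym)

text \<open>
  Joining \<open>p\<close> to \<open>p'\<close> merges two classes of a disjoint union into one, so one is lost. The
  hypotheses compare \<open>t\<close> with this union and its bridge only through the generated
  equivalences, because a connected sum removes edges of both relations and is therefore not an
  extension of them. The map \<open>f\<close> accounts for the renumbering of the second summand.
\<close>

lemma num_classes_glue:
  fixes r :: "'a \<Rightarrow> 'a \<Rightarrow> bool" and r' :: "'b \<Rightarrow> 'b \<Rightarrow> bool" and f :: "'b \<Rightarrow> 'a"
  assumes fin: "finite A" "finite B" and f: "inj f" and disj: "A \<inter> range f = {}"
    and p: "p \<in> A" "p' \<in> B"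
    and r: "\<And>x y. r x y \<Longrightarrow> equivclp t x y"
    and r': "\<And>x y. r' x y \<Longrightarrow> equivclp t (f x) (f y)"
    and bridge: "equivclp t p (f p')"
    and t: "\<And>x y. t x y \<Longrightarrow>
        (x \<in> A \<and> y \<in> A \<and> equivclp r x y) \<or>
        (\<exists>x' y'. x = f x' \<and> y = f y' \<and> equivclp r' x' y') \<or>
        (\<exists>y'. x \<in> A \<and> y = f y' \<and> equivclp r p x \<and> equivclp r' p' y') \<or>
        (\<exists>x'. x = f x' \<and> y \<in> A \<and> equivclp r' p' x' \<and> equivclp r p y)"
  shows "num_classes (A \<union> f ` B) t + 1 = num_classes A r + num_classes B r'"
proof -
  define cls where "cls = (\<lambda>x. {(x, y). equivclp r x y} `` {x})"
  define cls' where "cls' = (\<lambda>x. {(x, y). equivclp r' x y} `` {x})"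
  have cls_eq: "cls x = cls y \<longleftrightarrow> equivclp r x y" for x y
    unfolding cls_def by (rule equivclp_class_eq_iff)
  have cls'_eq: "cls' x = cls' y \<longleftrightarrow> equivclp r' x y" for x y
    unfolding cls'_def by (rule equivclp_class_eq_iff)
  \<comment> \<open>A point is labelled by its old class, where the class of \<open>p'\<close> takes the label of that of \<open>p\<close>.\<close>
  define lab where "lab = (\<lambda>z. if z \<in> A then Inl (cls z)
    else if cls' (inv f z) = cls' p' then Inl (cls p) else Inr (cls' (inv f z)))"
  have lab_A: "lab x = Inl (cls x)" if "x \<in> A" for x
    using that by (simp add: lab_def)
  have lab_f: "lab (f x) = (if cls' x = cls' p' then Inl (cls p) else Inr (cls' x))" for x
  proof -
    have "f x \<notin> A" using disj by blast
    then show ?thesis by (simp add: lab_def inv_f_f[OF f])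
  qed
  have lift: "equivclp t x y" if "cls x = cls y" for x y
    using equivclp_map[of r x y t id] that r by (simp add: cls_eq)
  have lift': "equivclp t (f x) (f y)" if "cls' x = cls' y" for x y
    using equivclp_map[of r' x y t f] that r' by (simp add: cls'_eq)
  have "num_classes (A \<union> f ` B) t = card (lab ` (A \<union> f ` B))"
  proof (rule num_classes_eq_card_image)
    fix x y assume "t x y"
    from t[OF this] show "lab x = lab y"
      unfolding cls_eq[symmetric] cls'_eq[symmetric]
      by (elim disjE exE conjE) (simp_all add: lab_A lab_f)
  next
    have AB: "equivclp t x (f y)" if "x \<in> A" "lab x = lab (f y)" for x y
    proof -
      have "cls x = cls p" "cls' p' = cls' y"
        using that by (simp_all add: lab_A lab_f split: if_splits)
      then show ?thesis
        by (rule equivclp_trans[OF lift equivclp_trans[OF bridge lift']])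
    qed
    have BB: "equivclp t (f x) (f y)" if "lab (f x) = lab (f y)" for x y
      using that by (intro lift') (simp add: lab_f split: if_splits)
    fix x y assume "x \<in> A \<union> f ` B" "y \<in> A \<union> f ` B" and eq: "lab x = lab y"
    then consider "x \<in> A" "y \<in> A" | y' where "x \<in> A" "y = f y'"
      | x' where "x = f x'" "y \<in> A" | x' y' where "x = f x'" "y = f y'"
      by blast
    then show "equivclp t x y"
    proof cases
      case 1
      then show ?thesis using eq by (intro lift) (simp add: lab_A)
    next
      case 2
      then show ?thesis using AB eq by simp
    next
      case 3
      then show ?thesis using AB[of y x'] eq by (simp add: equivclp_sym)
    next
      case 4
      then show ?thesis using BB eq by simp
    qed
  qed
  also have "lab ` (A \<union> f ` B) = Inl ` cls ` A \<union> Inr ` (cls' ` B - {cls' p'})"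
    (is "?L = ?R")
  proof
    have "lab x \<in> ?R" if "x \<in> A" for x
      using that by (simp add: lab_A)
    moreover have "lab (f x) \<in> ?R" if "x \<in> B" for x
      using that p(1) by (cases "cls' x = cls' p'") (simp_all add: lab_f)
    ultimately show "?L \<subseteq> ?R" by blast
  next
    have "Inl (cls x) \<in> ?L" if "x \<in> A" for x
      using that by (intro image_eqI[of _ lab x]) (simp_all add: lab_A)
    moreover have "Inr (cls' x) \<in> ?L" if "x \<in> B" "cls' x \<noteq> cls' p'" for x
      using that by (intro image_eqI[of _ lab "f x"]) (simp_all add: lab_f)
    ultimately show "?R \<subseteq> ?L"
      by (intro Un_least image_subsetI) (elim DiffE imageE; simp)+
  qed
  also have "card \<dots> = card (cls ` A) + card (cls' ` B - {cls' p'})"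
    using fin by (subst card_Un_disjoint) (auto simp: card_image)
  also have "card (cls' ` B - {cls' p'}) = card (cls' ` B) - 1"
    using p(2) fin by (intro card_Diff_singleton) blast
  also have "card (cls ` A) = num_classes A r"
    unfolding num_classes_def quotient_def cls_def by (simp add: UNION_singleton_eq_range)
  also have "card (cls' ` B) = num_classes B r'"
    unfolding num_classes_def quotient_def cls'_def by (simp add: UNION_singleton_eq_range)
  finally have "num_classes (A \<union> f ` B) t = num_classes A r + (num_classes B r' - 1)" .
  moreover have "num_classes B r' > 0"
    using p(2) fin by (auto simp: num_classes_def card_gt_0_iff quotient_def)
  ultimately show ?thesis by simp
qed

section \<open>States of a connected sum\<close>

definition arc_involution :: "shadow \<Rightarrow> bool" where
  "arc_involution D \<longleftrightarrow>
     (\<forall>e\<in>ends D. arc D e \<in> ends D \<and> arc D e \<noteq> e \<and> arc D (arc D e) = e)"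

lemma finite_ends: "finite (ends D)"
proof -
  have "UNIV = {UL, LL, LR, UR}" by (auto intro: corner.exhaust)
  then have "finite (UNIV :: corner set)" by (metis finite.emptyI finite.insertI)
  then show ?thesis by (simp add: ends_def)
qed

lemma splice_involution: "splice s c \<noteq> c \<and> splice s (splice s c) = c"
  by (cases s; cases c) simp_all

lemma ends_iff: "e \<in> ends D \<longleftrightarrow> fst e < ncross D"
  by (cases e) (simp add: ends_def)

text \<open>
  The relation \<open>r\<close> is left open so that it can be the one of a connected sum, which contains
  all strands of either summand except the one that is cut.
\<close>

lemma cut_strand_connected:
  assumes D: "arc_involution D" and p: "p \<in> ends D"
    and splice: "\<And>e. e \<in> ends D \<Longrightarrow> r e (fst e, splice (S (fst e)) (snd e))"
    and strand: "\<And>e. e \<in> ends D \<Longrightarrow> e \<noteq> p \<Longrightarrow> e \<noteq> arc D p \<Longrightarrow> r e (arc D e)"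
  shows "equivclp r p (arc D p)"
proof (rule cut_circle_connected[where s = "\<lambda>e. (fst e, splice (S (fst e)) (snd e))"])
  show "finite (ends D)" by (rule finite_ends)
qed (use assms in \<open>auto simp: arc_involution_def ends_iff splice_involution prod_eq_iff\<close>)

lemma inj_shift: "inj (shift m)"
  by (auto simp: inj_def shift_def prod_eq_iff)

text \<open>
  Each new strand leads from one cut strand to the other, and within each summand the two
  ends of its cut strand are connected by the rest of their circle. So the sum induces the same
  equivalence as the two summands side by side with the two circles bridged.
\<close>

lemma num_circles_connected_sum:
  assumes D: "arc_involution D" and d: "d \<in> ends D"
    and D': "arc_involution D'" and d': "d' \<in> ends D'"
  shows "num_circles (connected_sum D (Strand d) D' (Strand d')) S + 1 =
    num_circles D S + num_circles D' (\<lambda>i. S (ncross D + i))"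
proof -
  define m where "m = ncross D"
  define E where "E = connected_sum D (Strand d) D' (Strand d')"
  let ?f = "shift m" and ?S' = "\<lambda>i. S (m + i)"
  let ?q = "arc D d" and ?q' = "arc D' d'"
  let ?r = "joined D S" and ?r' = "joined D' ?S'" and ?t = "joined E S"
  have arcD: "arc D e \<in> ends D" "arc D e \<noteq> e" "arc D (arc D e) = e" if "e \<in> ends D" for e
    using D that by (auto simp: arc_involution_def)
  have arcD': "arc D' e \<in> ends D'" "arc D' e \<noteq> e" "arc D' (arc D' e) = e"
    if "e \<in> ends D'" for e
    using D' that by (auto simp: arc_involution_def)
  have E_simps: "ncross E = m + ncross D'" "circles E = circles D + circles D'"
    "arc E = (juxtapose D D')(d := ?f d', ?f d' := d, ?q := ?f ?q', ?f ?q' := ?q)"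
    by (simp_all add: E_def Let_def m_def)
  have neq: "?f x \<noteq> e" "e \<noteq> ?f x" if "e \<in> ends D" for e x
    using that by (auto simp: shift_def ends_iff m_def)
  have f_eq: "?f x = ?f y \<longleftrightarrow> x = y" for x y
    using inj_shift by (rule inj_eq)
  have jux: "juxtapose D D' e = arc D e" if "e \<in> ends D" for e
    using that by (simp add: juxtapose_def ends_iff)
  have jux': "juxtapose D D' (?f e) = ?f (arc D' e)" for e
    by (simp add: juxtapose_def shift_def m_def)
  have arcE: "arc E e = (if e = d then ?f d' else if e = ?q then ?f ?q' else arc D e)"
    if "e \<in> ends D" for e
    using that arcD[OF d] by (simp add: E_simps jux neq)
  have arcE': "arc E (?f e) = (if e = d' then d else if e = ?q' then ?q else ?f (arc D' e))"
    if "e \<in> ends D'" for e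
    using that arcD'[OF d'] d arcD[OF d] by (simp add: E_simps jux' neq f_eq)
  have endsE: "ends E = ends D \<union> ?f ` ends D'"
  proof (intro equalityI subsetI)
    fix e assume e: "e \<in> ends E"
    show "e \<in> ends D \<union> ?f ` ends D'"
    proof (cases "fst e < m")
      case True
      then show ?thesis by (simp add: ends_iff m_def)
    next
      case False
      then have "e = ?f (fst e - m, snd e)" by (simp add: shift_def)
      moreover have "(fst e - m, snd e) \<in> ends D'"
        using e False by (simp add: ends_iff E_simps)
      ultimately show ?thesis by blast
    qed
  qed (auto simp: ends_iff E_simps shift_def m_def)
  have spliceE: "?t e (fst e, splice (S (fst e)) (snd e))" if "e \<in> ends D" for e
    using that by (simp add: joined_def endsE)
  have spliceE': "?t (?f e) (?f (fst e, splice (?S' (fst e)) (snd e)))" if "e \<in> ends D'" for e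
    using that by (auto simp: joined_def endsE) (auto simp: shift_def)
  have strandE: "?t e (arc D e)" if "e \<in> ends D" "e \<noteq> d" "e \<noteq> ?q" for e
    using that by (simp add: joined_def endsE arcE)
  have strandE': "?t (?f e) (?f (arc D' e))" if "e \<in> ends D'" "e \<noteq> d'" "e \<noteq> ?q'" for e
    using that by (simp add: joined_def endsE arcE')
  \<comment> \<open>Although the strands from \<open>d\<close> and \<open>d'\<close> are cut, their ends stay on a common circle.\<close>
  have dq: "equivclp ?t d ?q"
    by (rule cut_strand_connected[OF D d, of _ S]) (use spliceE strandE in auto)
  have "equivclp (\<lambda>x y. ?t (?f x) (?f y)) d' ?q'"
    by (rule cut_strand_connected[OF D' d', of _ ?S']) (use spliceE' strandE' in auto)
  then have dq': "equivclp ?t (?f d') (?f ?q')"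
    by (rule equivclp_map) (rule r_into_equivclp)
  have "num_classes (ends D \<union> ?f ` ends D') ?t + 1 =
      num_classes (ends D) ?r + num_classes (ends D') ?r'"
  proof (rule num_classes_glue)
    show "finite (ends D)" "finite (ends D')" by (rule finite_ends)+
    show "inj ?f" by (rule inj_shift)
    show "ends D \<inter> range ?f = {}" using neq by blast
    show "d \<in> ends D" "d' \<in> ends D'" by fact+
    show "equivclp ?t d (?f d')"
      using d by (intro r_into_equivclp) (simp add: joined_def endsE arcE)
  next
    fix x y assume xy: "?r x y"
    then have x: "x \<in> ends D" by (simp add: joined_def)
    consider "y = (fst x, splice (S (fst x)) (snd x))" | "y = arc D x" "x \<noteq> d" "x \<noteq> ?q"
      | "x = d" "y = ?q" | "x = ?q" "y = d"
      using xy arcD(3)[OF d] unfolding joined_def by metis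
    then show "equivclp ?t x y"
      by cases (use spliceE[OF x] strandE[OF x] r_into_equivclp[of ?t x y] dq
        equivclp_sym[OF dq] in simp_all)
  next
    fix x y assume xy: "?r' x y"
    then have x: "x \<in> ends D'" by (simp add: joined_def)
    consider "y = (fst x, splice (?S' (fst x)) (snd x))" | "y = arc D' x" "x \<noteq> d'" "x \<noteq> ?q'"
      | "x = d'" "y = ?q'" | "x = ?q'" "y = d'"
      using xy arcD'(3)[OF d'] unfolding joined_def by metis
    then show "equivclp ?t (?f x) (?f y)"
      by cases (use spliceE'[OF x] strandE'[OF x] r_into_equivclp[of ?t "?f x" "?f y"] dq'
        equivclp_sym[OF dq'] in simp_all)
  next
    fix x y assume xy: "?t x y"
    have rq: "equivclp ?r d ?q"
      using d by (intro r_into_equivclp) (simp add: joined_def)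
    have rq': "equivclp ?r' d' ?q'"
      using d' by (intro r_into_equivclp) (simp add: joined_def)
    from xy have "x \<in> ends D \<or> (\<exists>x'\<in>ends D'. x = ?f x')"
      by (auto simp: joined_def endsE)
    then show "(x \<in> ends D \<and> y \<in> ends D \<and> equivclp ?r x y) \<or>
        (\<exists>x' y'. x = ?f x' \<and> y = ?f y' \<and> equivclp ?r' x' y') \<or>
        (\<exists>y'. x \<in> ends D \<and> y = ?f y' \<and> equivclp ?r d x \<and> equivclp ?r' d' y') \<or>
        (\<exists>x'. x = ?f x' \<and> y \<in> ends D \<and> equivclp ?r' d' x' \<and> equivclp ?r d y)"
    proof (elim disjE bexE)
      assume x: "x \<in> ends D"
      from xy consider "y = (fst x, splice (S (fst x)) (snd x))" | "y = arc E x"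
        unfolding joined_def by blast
      then show ?thesis
      proof cases
        case 1
        then have "y \<in> ends D" "?r x y" using x by (simp_all add: ends_iff joined_def)
        then show ?thesis using x by (blast intro: r_into_equivclp)
      next
        case 2
        have "?r x (arc D x)" using x by (simp add: joined_def)
        then show ?thesis
          using 2 x arcE[OF x] arcD(1)[OF x] rq rq' equivclp_refl r_into_equivclp
          by (metis (full_types))
      qed
    next
      fix x' assume x': "x' \<in> ends D'" and x: "x = ?f x'"
      from xy consider "y = (fst x, splice (S (fst x)) (snd x))" | "y = arc E x"
        unfolding joined_def by blast
      then show ?thesis
      proof cases
        case 1
        then have "y = ?f (fst x', splice (?S' (fst x')) (snd x'))"
          by (simp add: x shift_def)
        moreover have "?r' x' (fst x', splice (?S' (fst x')) (snd x'))"
          using x' by (simp add: joined_def)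
        ultimately show ?thesis using x by (blast intro: r_into_equivclp)
      next
        case 2
        have "?r' x' (arc D' x')" using x' by (simp add: joined_def)
        then show ?thesis
          using 2 x arcE'[OF x'] d arcD(1)[OF d] rq rq' equivclp_refl r_into_equivclp
          by (metis (full_types))
      qed
    qed
  qed
  then have "num_circles E S + 1 = num_circles D S + num_circles D' ?S'"
    by (simp add: num_circles_def endsE E_simps)
  then show ?thesis by (simp only: E_def m_def)
qed

lemma num_circles_cong:
  assumes "\<And>i. i < ncross D \<Longrightarrow> S i = T i"
  shows "num_circles D S = num_circles D T"
proof -
  have "joined D S = joined D T"
    using assms by (auto simp: joined_def fun_eq_iff ends_iff)
  then show ?thesis by (simp add: num_circles_def)
qed

lemma bij_betw_PiE_append:
  "bij_betw (\<lambda>S. (restrict S {..<m}, restrict (\<lambda>i. S (m + i)) {..<k}))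
     ({..<m + k} \<rightarrow>\<^sub>E B) (({..<m :: nat} \<rightarrow>\<^sub>E B) \<times> ({..<k} \<rightarrow>\<^sub>E B))"
proof -
  let ?split = "\<lambda>S. (restrict S {..<m}, restrict (\<lambda>i. S (m + i)) {..<k})"
  let ?append = "\<lambda>(S, T). restrict (\<lambda>i. if i < m then S i else T (i - m)) {..<m + k}"
  show ?thesis
  proof (rule bij_betw_byWitness[where f' = ?append])
    show "\<forall>S\<in>{..<m + k} \<rightarrow>\<^sub>E B. ?append (?split S) = S"
      by (auto simp: fun_eq_iff PiE_iff extensional_def restrict_def)
    show "\<forall>ST\<in>({..<m} \<rightarrow>\<^sub>E B) \<times> ({..<k} \<rightarrow>\<^sub>E B). ?split (?append ST) = ST"
      by (auto simp: fun_eq_iff PiE_iff extensional_def restrict_def)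
    show "?split ` ({..<m + k} \<rightarrow>\<^sub>E B) \<subseteq> ({..<m} \<rightarrow>\<^sub>E B) \<times> ({..<k} \<rightarrow>\<^sub>E B)"
    proof (rule image_subsetI)
      fix S assume "S \<in> {..<m + k} \<rightarrow>\<^sub>E B"
      then have "S i \<in> B" if "i < m + k" for i using that by (simp add: PiE_iff)
      then show "?split S \<in> ({..<m} \<rightarrow>\<^sub>E B) \<times> ({..<k} \<rightarrow>\<^sub>E B)" by simp
    qed
    show "?append ` (({..<m} \<rightarrow>\<^sub>E B) \<times> ({..<k} \<rightarrow>\<^sub>E B)) \<subseteq> {..<m + k} \<rightarrow>\<^sub>E B"
    proof (rule image_subsetI)
      fix ST assume "ST \<in> ({..<m} \<rightarrow>\<^sub>E B) \<times> ({..<k} \<rightarrow>\<^sub>E B)"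
      then obtain S T where ST: "ST = (S, T)"
        and S: "\<And>i. i < m \<Longrightarrow> S i \<in> B" and T: "\<And>i. i < k \<Longrightarrow> T i \<in> B"
        by (auto simp: PiE_iff)
      have "(if i < m then S i else T (i - m)) \<in> B" if "i < m + k" for i
        using that S T[of "i - m"] by (cases "i < m") simp_all
      then show "?append ST \<in> {..<m + k} \<rightarrow>\<^sub>E B" by (simp add: ST)
    qed
  qed
qed

text \<open>
  The factor \<open>x\<close> stands for the circle that is lost; the two state sums are independent, so
  their product is the sum over pairs of states.
\<close>

theorem gen_poly_connected_sum:
  assumes "arc_involution D" "d \<in> ends D" "arc_involution D'" "d' \<in> ends D'"
  shows "[:0, 1:] * gen_poly (connected_sum D (Strand d) D' (Strand d')) =
    gen_poly D * gen_poly D'"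
proof -
  let ?E = "connected_sum D (Strand d) D' (Strand d')"
  let ?m = "ncross D" and ?k = "ncross D'"
  let ?h = "\<lambda>S. (restrict S {..<?m}, restrict (\<lambda>i. S (?m + i)) {..<?k})"
  let ?g = "\<lambda>(S, T). monom (1 :: int) (num_circles D S) * monom 1 (num_circles D' T)"
  have "[:0, 1:] * gen_poly ?E = (\<Sum>S\<in>states ?E. monom 1 (num_circles ?E S + 1))"
    by (simp add: gen_poly_def sum_distrib_left monom_Suc)
  also have "\<dots> = (\<Sum>S\<in>states ?E. ?g (?h S))"
  proof (rule sum.cong[OF refl])
    fix S
    have "num_circles D S = num_circles D (restrict S {..<?m})"
      by (rule num_circles_cong) simp
    moreover have "num_circles D' (\<lambda>i. S (?m + i)) =
        num_circles D' (restrict (\<lambda>i. S (?m + i)) {..<?k})"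
      by (rule num_circles_cong) simp
    ultimately show "monom 1 (num_circles ?E S + 1) = ?g (?h S)"
      unfolding num_circles_connected_sum[OF assms] by (simp add: mult_monom)
  qed
  also have "\<dots> = (\<Sum>ST\<in>states D \<times> states D'. ?g ST)"
  proof (rule sum.reindex_bij_betw)
    show "bij_betw ?h (states ?E) (states D \<times> states D')"
      using bij_betw_PiE_append[of ?m ?k "UNIV :: split set"]
      by (simp only: states_def connected_sum_ncross)
  qed
  also have "\<dots> = gen_poly D * gen_poly D'"
    by (simp add: gen_poly_def sum_product sum.cartesian_product)
  finally show ?thesis .
qed

section \<open>The trefoil\<close>

text \<open>
  Along the left and right arcs the stack closes up to a ring, so the bottom crossing counts as the
  one above the top crossing.
\<close>

definition above :: "nat \<Rightarrow> nat" where
  "above i = (if i = 0 then 2 else i - 1)"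

lemma above_simps: "above 0 = 2" "above (Suc 0) = 0" "above 2 = Suc 0" "above (Suc (Suc 0)) = Suc 0"
  by (simp_all add: above_def)

lemma lt3_cases: "i < 3 \<longleftrightarrow> i = 0 \<or> i = Suc 0 \<or> i = 2" for i :: nat
  by auto

lemma joined_trefoil_upper:
  assumes "i < 3"
  shows "equivclp (joined trefoil S) (i, UL) (above i, LL)"
    and "equivclp (joined trefoil S) (i, UR) (above i, LR)"
  using assms
  by (auto intro!: r_into_equivclp simp: joined_def ends_iff trefoil_def above_def)

lemma joined_trefoil_horizontal:
  assumes "i < 3" "S i = Split0"
  shows "equivclp (joined trefoil S) (i, LR) (i, LL)"
  using assms by (intro r_into_equivclp) (simp add: joined_def ends_iff trefoil_def)

lemma joined_trefoil_vertical:
  assumes i: "i < 3" "S i = Split1"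
  shows "equivclp (joined trefoil S) (i, LL) (above i, LL)"
    and "equivclp (joined trefoil S) (i, LR) (above i, LR)"
proof -
  have "equivclp (joined trefoil S) (i, LL) (i, UL)" "equivclp (joined trefoil S) (i, LR) (i, UR)"
    using i by (auto intro!: r_into_equivclp simp: joined_def ends_iff trefoil_def)
  then show "equivclp (joined trefoil S) (i, LL) (above i, LL)"
      "equivclp (joined trefoil S) (i, LR) (above i, LR)"
    using joined_trefoil_upper[OF i(1)] by (blast intro: equivclp_trans)+
qed

text \<open>The left and the right sides of the crossings form one circle each.\<close>

lemma trefoil_num_circles_vertical:
  assumes S: "\<And>i. i < 3 \<Longrightarrow> S i = Split1"
  shows "num_circles trefoil S = 2"
proof -
  let ?r = "joined trefoil S"
  define lab :: "cend \<Rightarrow> corner" where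
    "lab = (\<lambda>(i, c). if c = UL \<or> c = LL then LL else LR)"
  have lower: "equivclp ?r (i, c) (0, c)" if "i < 3" "c = LL \<or> c = LR" for i c
  proof -
    have 1: "equivclp ?r (1, c) (0, c)" and 2: "equivclp ?r (2, c) (1, c)"
      using that joined_trefoil_vertical[of 1 S] joined_trefoil_vertical[of 2 S] S
      by (auto simp: above_simps)
    from that(1) show ?thesis using 1 equivclp_trans[OF 2 1] by (auto simp: lt3_cases)
  qed
  have "num_classes (ends trefoil) ?r = card (lab ` ends trefoil)"
  proof (rule num_classes_eq_card_labels[where rep = "\<lambda>c. (0, c)"])
    fix x y assume "?r x y"
    then show "lab x = lab y"
      using S by (cases x; cases "snd x")
        (auto simp: joined_def lab_def ends_iff trefoil_def)
  next
    fix x assume "x \<in> ends trefoil"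
    then obtain i c where x: "x = (i, c)" and i: "i < 3"
      by (cases x) (auto simp: ends_iff trefoil_def)
    have "above i < 3" using i by (auto simp: above_def)
    then show "equivclp ?r x (0, lab x)"
      using lower[of i c] lower[of "above i"] joined_trefoil_upper[OF i, of S] i unfolding x
      by (cases c) (auto simp: lab_def intro: equivclp_trans)
  qed
  also have "lab ` ends trefoil = {LL, LR}"
  proof -
    have "lab (0, LL) = LL" "lab (0, LR) = LR" "(0, LL) \<in> ends trefoil" "(0, LR) \<in> ends trefoil"
      by (simp_all add: lab_def ends_iff trefoil_def)
    then have "{LL, LR} \<subseteq> lab ` ends trefoil" by (metis empty_subsetI imageI insert_subset)
    moreover have "lab ` ends trefoil \<subseteq> {LL, LR}" by (auto simp: lab_def)
    ultimately show ?thesis by blast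
  qed
  finally show ?thesis by (simp add: num_circles_def) (simp add: trefoil_def)
qed

text \<open>
  A horizontal split closes off the ring, and vertical splits let both sides pass. So each circle
  is bounded above by one horizontally split crossing, which serves as its label.
\<close>

lemma trefoil_num_circles_horizontal:
  assumes S: "\<exists>i<3. S i = Split0"
  shows "num_circles trefoil S = card {i. i < 3 \<and> S i = Split0}"
proof -
  let ?r = "joined trefoil S"
  \<comment> \<open>The nearest horizontal split at or above \<open>i\<close>; two steps up suffice in a ring of three.\<close>
  define cap where "cap i = (if S i = Split0 then i
    else if S (above i) = Split0 then above i else above (above i))" for i
  define lab :: "cend \<Rightarrow> nat" where
    "lab = (\<lambda>(i, c). cap (if c = LL \<or> c = LR then i else above i))"
  have above_lt: "above i < 3" if "i < 3" for i using that by (auto simp: above_def)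
  have cap: "cap i < 3 \<and> S (cap i) = Split0" if "i < 3" for i
    using that S by (auto simp: cap_def lt3_cases above_simps)
  have cap_above: "cap i = cap (above i)" if "i < 3" "S i = Split1" for i
    using that S by (auto simp: cap_def lt3_cases above_simps)
  have left: "equivclp ?r (i, LL) (cap i, LL)" if i: "i < 3" for i
  proof -
    have 1: "equivclp ?r (i, LL) (above i, LL)" if "S i \<noteq> Split0"
      using joined_trefoil_vertical(1)[OF i] that by (cases "S i") auto
    have 2: "equivclp ?r (above i, LL) (above (above i), LL)" if "S (above i) \<noteq> Split0"
      using joined_trefoil_vertical(1)[OF above_lt[OF i]] that by (cases "S (above i)") auto
    show ?thesis using 1 2 by (auto simp: cap_def intro: equivclp_trans)
  qed
  have right: "equivclp ?r (i, LR) (cap i, LL)" if i: "i < 3" for i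
  proof -
    have 1: "equivclp ?r (i, LR) (above i, LR)" if "S i \<noteq> Split0"
      using joined_trefoil_vertical(2)[OF i] that by (cases "S i") auto
    have 2: "equivclp ?r (above i, LR) (above (above i), LR)" if "S (above i) \<noteq> Split0"
      using joined_trefoil_vertical(2)[OF above_lt[OF i]] that by (cases "S (above i)") auto
    have "equivclp ?r (i, LR) (cap i, LR)"
      using 1 2 by (auto simp: cap_def intro: equivclp_trans)
    moreover have "equivclp ?r (cap i, LR) (cap i, LL)"
      using cap[OF i] by (blast intro: joined_trefoil_horizontal)
    ultimately show ?thesis by (rule equivclp_trans)
  qed
  have "num_classes (ends trefoil) ?r = card (lab ` ends trefoil)"
  proof (rule num_classes_eq_card_labels[where rep = "\<lambda>i. (i, LL)"])
    fix x y assume r: "?r x y"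
    obtain i c where x: "x = (i, c)" by (cases x)
    have i: "i < 3" using r x by (simp add: joined_def ends_iff trefoil_def)
    consider "y = arc trefoil (i, c)" | "y = (i, splice (S i) c)"
      using r x by (auto simp: joined_def)
    then show "lab x = lab y"
    proof cases
      case 1
      then show ?thesis unfolding x
        using i by (cases c) (auto simp: lab_def trefoil_def lt3_cases above_simps)
    next
      case 2
      then show ?thesis unfolding x
        using cap_above[OF i] by (cases c; cases "S i") (auto simp: lab_def)
    qed
  next
    fix x assume "x \<in> ends trefoil"
    then obtain i c where x: "x = (i, c)" and i: "i < 3"
      by (cases x) (auto simp: ends_iff trefoil_def)
    show "equivclp ?r x (lab x, LL)"
      using left[OF i] right[OF i] left[OF above_lt[OF i]] right[OF above_lt[OF i]]
        joined_trefoil_upper[OF i, of S] unfolding x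
      by (cases c) (auto simp: lab_def intro: equivclp_trans)
  qed
  also have "lab ` ends trefoil = {i. i < 3 \<and> S i = Split0}"
  proof (intro equalityI subsetI)
    fix l assume "l \<in> lab ` ends trefoil"
    then show "l \<in> {i. i < 3 \<and> S i = Split0}"
      using cap above_lt by (auto simp: lab_def ends_iff trefoil_def)
  next
    fix l assume "l \<in> {i. i < 3 \<and> S i = Split0}"
    then have "lab (l, LL) = l" "(l, LL) \<in> ends trefoil"
      by (simp_all add: lab_def cap_def ends_iff trefoil_def)
    then show "l \<in> lab ` ends trefoil" by (metis imageI)
  qed
  finally show ?thesis by (simp add: num_circles_def) (simp add: trefoil_def)
qed

text \<open>
  Giving each type \<open>0\<close> split the weight \<open>x\<close> yields the right power of \<open>x\<close> except for the all-vertical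
  state, which has weight \<open>1\<close> instead of \<open>x^2\<close>. The weights are multiplicative, so their sum
  factorizes as \<open>(x + 1)^3\<close>.
\<close>

lemma gen_poly_trefoil: "gen_poly trefoil = [:0, 1:] * [:3, 4, 1:]"
proof -
  let ?x = "[:0, 1:] :: int poly"
  let ?w = "\<lambda>s. if s = Split0 then ?x else 1"
  let ?S1 = "restrict (\<lambda>_. Split1) {..<3 :: nat}"
  have states: "states trefoil = {..<3} \<rightarrow>\<^sub>E UNIV"
    by (simp add: states_def trefoil_def)
  have UNIV_split: "UNIV = {Split0, Split1}" by (auto intro: split.exhaust)
  then have fin_split: "finite (UNIV :: split set)" by (metis finite.emptyI finite.insertI)
  have fin: "finite (states trefoil)"
    unfolding states by (intro finite_PiE) (simp_all add: fin_split)
  have "monom 1 (num_circles trefoil S) =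
      (\<Prod>i<3. ?w (S i)) + (if S = ?S1 then ?x ^ 2 - 1 else 0)"
    if S: "S \<in> states trefoil" for S
  proof (cases "\<exists>i<3. S i = Split0")
    case True
    then have "S \<noteq> ?S1" by auto
    moreover have "(\<Prod>i<3. ?w (S i)) = ?x ^ card {i. i < 3 \<and> S i = Split0}"
      by (simp add: prod.If_cases Int_def conj_commute)
    ultimately show ?thesis
      using trefoil_num_circles_horizontal[OF True] by (simp add: monom_altdef)
  next
    case False
    then have S1: "S i = Split1" if "i < 3" for i using that by (cases "S i") auto
    have "S = ?S1" using S S1 by (auto simp: states PiE_iff extensional_def fun_eq_iff)
    moreover have "(\<Prod>i<3. ?w (S i)) = 1" using S1 by (intro prod.neutral) simp
    moreover have "num_circles trefoil S = 2" using S1 by (rule trefoil_num_circles_vertical)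
    ultimately show ?thesis by (simp only: if_True) (simp add: monom_altdef)
  qed
  then have "gen_poly trefoil =
      (\<Sum>S\<in>states trefoil. (\<Prod>i<3. ?w (S i)) + (if S = ?S1 then ?x ^ 2 - 1 else 0))"
    unfolding gen_poly_def by (rule sum.cong[OF refl])
  also have "\<dots> = (\<Sum>S\<in>states trefoil. \<Prod>i<3. ?w (S i)) + (?x ^ 2 - 1)"
    using fin by (simp add: sum.distrib states)
  also have "(\<Sum>S\<in>states trefoil. \<Prod>i<3. ?w (S i)) = (\<Prod>i\<in>{..<3 :: nat}. \<Sum>s\<in>UNIV. ?w s)"
    unfolding states by (rule prod_sum_PiE[symmetric]) (simp_all add: fin_split)
  also have "\<dots> = (?x + 1) ^ 3" by (simp add: UNIV_split)
  also have "(?x + 1) ^ 3 + (?x ^ 2 - 1) = ?x * [:3, 4, 1:]"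
    by (simp add: power3_eq_cube power2_eq_square one_pCons)
  finally show ?thesis .
qed

section \<open>The overhand knots\<close>

lemma arc_involution_overhand: "arc_involution (overhand n)"
  unfolding arc_involution_def using overhand_involution by blast

lemma gen_poly_unknot: "gen_poly unknot = [:0, 1:]"
  by (simp add: gen_poly_def states_def unknot_def num_circles_def num_classes_def ends_def
      monom_altdef)

text \<open>
  The first step absorbs the crossingless circle instead of cutting two strands, so it is
  not an instance of multiplicativity: there \<open>overhand_1\<close> identifies the sum as the trefoil itself.
\<close>

lemma gen_poly_overhand_Suc:
  "gen_poly (overhand (Suc n)) = [:3, 4, 1:] * gen_poly (overhand n)"
proof (cases n)
  case 0
  then have "overhand (Suc n) = trefoil" using overhand_1 by (simp only: One_nat_def)
  with 0 show ?thesis by (simp only: gen_poly_trefoil overhand.simps(1) gen_poly_unknot mult_ac)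
next
  case (Suc k)
  have "[:0, 1:] * gen_poly (connected_sum (overhand n) (Strand (3 * k, UR)) trefoil
      (Strand (0, UL))) = gen_poly (overhand n) * gen_poly trefoil"
  proof (rule gen_poly_connected_sum)
    show "arc_involution trefoil" using arc_involution_overhand[of 1] by (simp only: overhand_1)
    show "(3 * k, UR) \<in> ends (overhand n)" by (simp only: ends_iff overhand_ncross) (simp add: Suc)
    show "(0, UL) \<in> ends trefoil" by (simp add: ends_iff trefoil_def)
  qed (rule arc_involution_overhand)
  moreover have "overhand (Suc n) =
      connected_sum (overhand n) (Strand (3 * k, UR)) trefoil (Strand (0, UL))"
    by (simp only: overhand.simps Suc right_arc.simps left_arc_def)
  ultimately have "[:0, 1:] * gen_poly (overhand (Suc n)) =
      [:0, 1:] * ([:3, 4, 1:] * gen_poly (overhand n))"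
    by (simp only: gen_poly_trefoil mult_ac)
  then show ?thesis by (subst (asm) mult_left_cancel) simp_all
qed

theorem theorem34:
  shows "(\<forall>n\<ge>1. gen_poly (overhand n) = [:3, 4, 1:] * gen_poly (overhand (n - 1))) \<and>
         (\<forall>n. gen_poly (overhand n) = [:0, 1:] * [:3, 4, 1:] ^ n)"
proof -
  have "gen_poly (overhand n) = [:0, 1:] * [:3, 4, 1:] ^ n" for n
  proof (induction n)
    case 0
    show ?case by (simp add: gen_poly_unknot)
  next
    case (Suc n)
    then show ?case by (simp only: gen_poly_overhand_Suc power_Suc mult_ac)
  qed
  moreover have "gen_poly (overhand n) = [:3, 4, 1:] * gen_poly (overhand (n - 1))"
    if "n \<ge> 1" for n
    using gen_poly_overhand_Suc[of "n - 1"] that by simp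
  ultimately show ?thesis by blast
qed

end
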